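(* Let the birth and death rates of a birth-and-death process be $\lambda_n$ and $\mu_n$, all in $(0,\infty)$. Then: (1) The birth-and-death process is transient if there exist a real number $c>1$, an integer $K\geq 1$ and a number $n_0$ such that for all $n>n_0$ $$\frac{\lambda_{n}}{\mu_{n}}\geq 1+\frac{1}{n}+\frac{1}{n}\sum_{k=1}^{K-1}\frac{1}{\prod_{j=1}^{k}\ln_{(j)}n}+\frac{c}{n\prod_{j=1}^{K}\ln_{(j)}n}.$$ (2) The birth-and-death process is recurrent if there exist an integer $K\geq 1$ and a number $n_0$ such that for all $n>n_0$ $$\frac{\lambda_{n}}{\mu_{n}}\leq 1+\frac{1}{n}+\frac{1}{n}\sum_{i=1}^{K}\frac{1}{\prod_{j=1}^{i}\ln_{(j)}n}.$$
   Context: $\ln_{(k)}x$ denotes the $k$th iterate of the natural logarithm: $\ln_{(1)}x=\ln x$, and $\ln_{(k)}x=\ln_{(k-1)}(\ln x)$ for $k\geq 2$. The number $n_0$ is understood to be large enough that $\ln_{(K)}n$ is defined and positive for all $n>n_0$. The empty sum is $0$. A birth-and-death process with birth rates $\lambda_n$ ($n\geq 0$) and death rates $\mu_n$ ($n\geq 1$) is the continuous-time Markov chain on the state space $\{0,1,2,\dots\}$ which jumps from $n$ to $n+1$ at rate $\lambda_n$ (for $n\geq 0$) and from $n$ to $n-1$ at rate $\mu_n$ (for $n\geq 1$), with no other transitions. Thus its sequence of visited states (the embedded jump chain) moves from $0$ to $1$ with probability $1$, and from $n\geq 1$ to $n+1$ with probability $\lambda_n/(\lambda_n+\mu_n)$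 and to $n-1$ with probability $\mu_n/(\lambda_n+\mu_n)$. The process is recurrent if, started from state $0$, it returns to state $0$ with probability $1$ (equivalently, the irreducible embedded jump chain is recurrent), and transient otherwise. *)

theory Defs
  imports "HOL-Probability.Probability"
begin

text \<open>
  The value \<open>death 0\<close> is never used: state 0 is left only by a birth.
\<close>

definition bd_rate :: "(nat \<Rightarrow> real) \<Rightarrow> (nat \<Rightarrow> real) \<Rightarrow> nat \<Rightarrow> nat \<Rightarrow> real" where
  "bd_rate birth death i j =
     (if j = Suc i then birth i else if i = Suc j then death i else 0)"

definition bd_exit_rate :: "(nat \<Rightarrow> real) \<Rightarrow> (nat \<Rightarrow> real) \<Rightarrow> nat \<Rightarrow> real" where
  "bd_exit_rate birth death i = birth i + (if i = 0 then 0 else death i)"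

text \<open>
  The joint law of the visited states \<open>Y\<close> and the holding times \<open>S\<close>, for the process
  started in state 0: \<open>Y\<close> is a Markov chain with jump probabilities \<open>q i j / q i\<close> (where \<open>q i j\<close>
  is the transition rate and \<open>q i\<close> the total rate out of \<open>i\<close>), and given \<open>Y\<close> the holding times
  are independent, the one of the \<open>i\<close>-th visited state being exponential with rate \<open>q (Y i)\<close>.
\<close>

definition bd_jumps_holding ::
  "'a measure \<Rightarrow> (nat \<Rightarrow> real) \<Rightarrow> (nat \<Rightarrow> real) \<Rightarrow>
     (nat \<Rightarrow> 'a \<Rightarrow> nat) \<Rightarrow> (nat \<Rightarrow> 'a \<Rightarrow> real) \<Rightarrow> bool" where
  "bd_jumps_holding M birth death Y S \<longleftrightarrow>
     (\<forall>n. Y n \<in> measurable M (count_space UNIV)) \<and>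
     (\<forall>n. S n \<in> borel_measurable M) \<and>
     (\<forall>n (y :: nat \<Rightarrow> nat) (t :: nat \<Rightarrow> real). (\<forall>i\<le>n. 0 \<le> t i) \<longrightarrow>
        measure M {\<omega> \<in> space M. \<forall>i\<le>n. Y i \<omega> = y i \<and> t i < S i \<omega>} =
          of_bool (y 0 = 0) *
          (\<Prod>i<n. bd_rate birth death (y i) (y (Suc i)) / bd_exit_rate birth death (y i)) *
          (\<Prod>i\<le>n. exp (- bd_exit_rate birth death (y i) * t i)))"

text \<open>
  The process at time \<open>t\<close> is in the \<open>n\<close>-th visited state when
  \<open>S 0 + \<dots> + S (n - 1) \<le> t < S 0 + \<dots> + S n\<close>. The value \<open>None\<close> is the cemetery state, which is
  entered after infinitely many jumps in finite time (explosion) and never left.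
\<close>

definition jump_process :: "(nat \<Rightarrow> 'a \<Rightarrow> nat) \<Rightarrow> (nat \<Rightarrow> 'a \<Rightarrow> real) \<Rightarrow> real \<Rightarrow> 'a \<Rightarrow> nat option" where
  "jump_process Y S t \<omega> =
     (if \<exists>n. t < (\<Sum>i\<le>n. S i \<omega>)
      then Some (Y (LEAST n. t < (\<Sum>i\<le>n. S i \<omega>)) \<omega>)
      else None)"

definition birth_death_process ::
  "'a measure \<Rightarrow> (nat \<Rightarrow> real) \<Rightarrow> (nat \<Rightarrow> real) \<Rightarrow> (real \<Rightarrow> 'a \<Rightarrow> nat option) \<Rightarrow> bool" where
  "birth_death_process M birth death X \<longleftrightarrow>
     prob_space M \<and>
     (\<exists>Y S. bd_jumps_holding M birth death Y S \<and>
        (AE \<omega> in M. \<forall>t\<ge>0. X t \<omega> = jump_process Y S t \<omega>))"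

text \<open>
  Recurrence and transience of a process started in state 0. A return requires the process to
  have been outside 0 in between.
\<close>

definition returns_to_0 :: "(real \<Rightarrow> 'a \<Rightarrow> nat option) \<Rightarrow> 'a \<Rightarrow> bool" where
  "returns_to_0 X \<omega> \<longleftrightarrow>
     (\<exists>s t. 0 \<le> s \<and> s < t \<and> X s \<omega> \<noteq> Some 0 \<and> X t \<omega> = Some 0)"

definition recurrent :: "'a measure \<Rightarrow> (real \<Rightarrow> 'a \<Rightarrow> nat option) \<Rightarrow> bool" where
  "recurrent M X \<longleftrightarrow> (AE \<omega> in M. returns_to_0 X \<omega>)"

definition transient :: "'a measure \<Rightarrow> (real \<Rightarrow> 'a \<Rightarrow> nat option) \<Rightarrow> bool" where
  "transient M X \<longleftrightarrow> \<not> recurrent M X"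

text \<open>
  \<open>ln\<close> is a total function here, so that the \<open>K\<close>-th iterate is genuinely defined and positive
  at \<open>x\<close> has to be expressed by positivity of all the iterates up to the \<open>K\<close>-th.
\<close>

definition iter_ln_pos :: "nat \<Rightarrow> real \<Rightarrow> bool" where
  "iter_ln_pos K x \<longleftrightarrow> 0 < x \<and> (\<forall>j\<in>{1..K}. 0 < (ln ^^ j) x)"

end

theory Submission
  imports Defs "HOL-Real_Asymp.Real_Asymp"
begin

text \<open>
  Let \<open>r k\<close> be the product of \<open>death i / birth i\<close> over \<open>i = 1, \<dots>, k\<close>. The scale function
  \<open>h x = r 0 + \<dots> + r (x - 1)\<close> vanishes in 0 and is harmonic for the embedded jump chain at all other
  states. If \<open>h\<close> has a finite limit \<open>H\<close>, then \<open>h x / H\<close> is a lower bound for the probability of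
  never reaching 0 from \<open>x\<close>. That probability is itself harmonic and vanishes in 0,
  hence it is a multiple of \<open>h\<close>; as it is bounded, it is zero whenever \<open>h\<close> is unbounded. So
  the chain is recurrent if and only if the series of the \<open>r k\<close> diverges. Since holding times are
  almost surely positive, returns of the process are the same as returns of the chain, which gives
  \<open>recurrent_iff_not_summable\<close>.

  It remains to decide the convergence of a positive series from its ratios
  \<open>r (n - 1) / r n = birth n / death n\<close>. Let \<open>L x\<close> be the product of \<open>x\<close> and its first \<open>K\<close>
  iterated logarithms. Both bounds on the ratio are statements about the logarithmic
  derivative of \<open>L\<close>: the critical one is \<open>1 + L' n / L n\<close>, and
  the one for transience exceeds it by \<open>(c - 1) / L n\<close>. Thus Kummer's test with the weights \<open>L\<close>
  compares \<open>L n + L' n\<close> with \<open>L (n + 1)\<close>. Here \<open>L\<close> is convex, which makes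
  \<open>r n * L (n + 1)\<close> increasing in the critical case, so that the series diverges with the sum of
  \<open>1 / L\<close> (\<open>bertrand_test_divergence\<close>). And \<open>L (n + 1) - L n - L' n\<close> tends to 0, so that a
  surplus \<open>c - 1 > 0\<close> suffices for convergence (\<open>bertrand_test_convergence\<close>).
\<close>

section \<open>Iterated logarithms\<close>

lemma iter_ln_pos_iff: "iter_ln_pos K x \<longleftrightarrow> (\<forall>j\<le>K. 0 < (ln ^^ j) x)"
proof -
  have "j = 0 \<or> j \<in> {1..K}" if "j \<le> K" for j using that by auto
  then show ?thesis unfolding iter_ln_pos_def by (metis atLeastAtMost_iff funpow_0 le0)
qed

lemma iter_ln_mono:
  assumes "iter_ln_pos K x" "x \<le> y" "j \<le> Suc K"
  shows "(ln ^^ j) x \<le> (ln ^^ j) y"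
  using assms(3)
proof (induction j)
  case (Suc j)
  then have "0 < (ln ^^ j) x" "(ln ^^ j) x \<le> (ln ^^ j) y"
    using assms(1) by (auto simp: iter_ln_pos_iff)
  then show ?case by simp
qed (use assms in simp)

lemma iter_ln_pos_mono: "iter_ln_pos K x \<Longrightarrow> x \<le> y \<Longrightarrow> iter_ln_pos K y"
  unfolding iter_ln_pos_iff[of K y]
proof (intro allI impI)
  fix j assume "iter_ln_pos K x" "x \<le> y" "j \<le> K"
  then show "0 < (ln ^^ j) y"
    using iter_ln_mono[of K x y j] by (auto simp: iter_ln_pos_iff intro: less_le_trans)
qed

lemma filterlim_iter_ln: "filterlim (\<lambda>n. (ln ^^ j) (real n)) at_top sequentially"
proof (induction j)
  case (Suc j)
  then show ?case using filterlim_compose[OF ln_at_top Suc] by simp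
qed (simp add: filterlim_real_sequentially)

lemma eventually_iter_ln_ge_1:
  "eventually (\<lambda>n. \<forall>j\<le>K. 1 \<le> (ln ^^ j) (real n)) sequentially"
proof -
  have "eventually (\<lambda>n. \<forall>j\<in>{..K}. 1 \<le> (ln ^^ j) (real n)) sequentially"
    using filterlim_iter_ln by (intro eventually_ball_finite) (auto simp: filterlim_at_top)
  then show ?thesis by (simp only: Ball_def atMost_iff)
qed

lemma iter_ln_pos_if_ge_1: "(\<And>j. j \<le> K \<Longrightarrow> 1 \<le> (ln ^^ j) x) \<Longrightarrow> iter_ln_pos K x"
  by (force simp: iter_ln_pos_iff)

lemma eventually_iter_ln_pos:
  "eventually (\<lambda>n. iter_ln_pos K (real (Suc n))) sequentially"
  using eventually_sequentially_Suc[THEN iffD2, OF eventually_iter_ln_ge_1[of K]]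
  by eventually_elim (auto intro: iter_ln_pos_if_ge_1)

section \<open>The Bertrand functions\<close>

text \<open>
  The reciprocals at the integers are the terms of the series that Bertrand's ratio tests use for
  comparison.
\<close>

definition bertrand :: "nat \<Rightarrow> real \<Rightarrow> real" where
  "bertrand K x = (\<Prod>j\<le>K. (ln ^^ j) x)"

lemma bertrand_eq: "bertrand K x = x * (\<Prod>j=1..K. (ln ^^ j) x)"
  unfolding bertrand_def atMost_atLeast0 by (simp add: prod.atLeast_Suc_atMost)

lemma bertrand_pos: "iter_ln_pos K x \<Longrightarrow> 0 < bertrand K x"
  unfolding bertrand_def iter_ln_pos_iff by (intro prod_pos) auto

text \<open>
  Primitives of the reciprocals of the Bertrand functions are thus again iterated logarithms.
  They are unbounded, which is why the corresponding series diverge.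
\<close>

lemma iter_ln_has_derivative:
  assumes "iter_ln_pos K x"
  shows "((ln ^^ Suc K) has_real_derivative 1 / bertrand K x) (at x)"
  using assms
proof (induction K)
  case 0
  then show ?case
    by (auto simp: bertrand_def iter_ln_pos_iff intro!: derivative_eq_intros)
next
  case (Suc K)
  then have pos: "0 < (ln ^^ Suc K) x"
    and "((ln ^^ Suc K) has_real_derivative 1 / bertrand K x) (at x)"
    by (auto simp: iter_ln_pos_iff simp del: funpow.simps)
  then have "((\<lambda>y. ln ((ln ^^ Suc K) y)) has_real_derivative
      1 / (ln ^^ Suc K) x * (1 / bertrand K x)) (at x)"
    by (intro DERIV_chain2[OF DERIV_ln_divide])
  moreover have "(ln ^^ Suc (Suc K)) = (\<lambda>y::real. ln ((ln ^^ Suc K) y))"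
    by (simp add: fun_eq_iff)
  moreover have "bertrand (Suc K) x = bertrand K x * (ln ^^ Suc K) x"
    unfolding bertrand_def by (rule prod.atMost_Suc)
  ultimately show ?case by (metis (no_types) mult.commute mult.right_neutral times_divide_times_eq)
qed

text \<open>
  This is the derivative of \<^term>\<open>bertrand K\<close>, written without division: from this form it is
  evident that it increases. The logarithmic derivative below is the form that occurs in
  ratio tests.
\<close>

definition bertrand_slope :: "nat \<Rightarrow> real \<Rightarrow> real" where
  "bertrand_slope K x = (\<Sum>i\<le>K. \<Prod>j\<in>{i<..K}. (ln ^^ j) x)"

lemma bertrand_slope_eq:
  assumes "iter_ln_pos K x"
  shows "bertrand_slope K x = bertrand K x * (\<Sum>i\<le>K. 1 / bertrand i x)"
  unfolding bertrand_slope_def sum_distrib_left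
proof (intro sum.cong refl)
  fix i assume i: "i \<in> {..K}"
  then have "{..K} = {..i} \<union> {i<..K}" by auto
  then have "bertrand K x = bertrand i x * (\<Prod>j\<in>{i<..K}. (ln ^^ j) x)"
    unfolding bertrand_def by (simp only:) (intro prod.union_disjoint; auto)
  moreover have "bertrand i x > 0"
    using assms i by (intro bertrand_pos) (auto simp: iter_ln_pos_iff)
  ultimately show "(\<Prod>j\<in>{i<..K}. (ln ^^ j) x) = bertrand K x * (1 / bertrand i x)"
    by simp
qed

lemma bertrand_has_derivative:
  assumes "iter_ln_pos K x"
  shows "(bertrand K has_real_derivative bertrand_slope K x) (at x)"
  unfolding bertrand_slope_eq[OF assms]
  using assms
proof (induction K)
  case 0
  then show ?case by (auto simp: bertrand_def[abs_def] iter_ln_pos_iff)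
next
  case (Suc K)
  then have pos: "iter_ln_pos K x" "0 < (ln ^^ Suc K) x"
    by (auto simp: iter_ln_pos_iff simp del: funpow.simps)
  note b = bertrand_pos[OF pos(1)]
  have eq: "bertrand (Suc K) = (\<lambda>y. bertrand K y * (ln ^^ Suc K) y)"
    unfolding bertrand_def[abs_def] by (simp only: prod.atMost_Suc)
  have "(bertrand (Suc K) has_real_derivative
     bertrand K x * (\<Sum>i\<le>K. 1 / bertrand i x) * (ln ^^ Suc K) x + 1 / bertrand K x * bertrand K x) (at x)"
    unfolding eq by (rule DERIV_mult[OF Suc.IH[OF pos(1)] iter_ln_has_derivative[OF pos(1)]])
  also have "bertrand K x * (\<Sum>i\<le>K. 1 / bertrand i x) * (ln ^^ Suc K) x + 1 / bertrand K x * bertrand K x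
      = bertrand (Suc K) x * (\<Sum>i\<le>Suc K. 1 / bertrand i x)"
    using b pos(2) unfolding sum.atMost_Suc eq by (simp add: field_simps del: funpow.simps)
  finally show ?case .
qed

lemma bertrand_slope_mono:
  assumes "iter_ln_pos K x" "x \<le> y"
  shows "bertrand_slope K x \<le> bertrand_slope K y"
  unfolding bertrand_slope_def
  using iter_ln_mono[OF assms] assms(1)
  by (intro sum_mono prod_mono) (auto simp: iter_ln_pos_iff less_imp_le)

text \<open>
  The slope increases, so the function is convex and its increments lie between the slopes at
  the two ends. The lower bound is exactly what the recurrent case needs.
\<close>

lemma bertrand_step_bounds:
  assumes "iter_ln_pos K x"
  shows "bertrand_slope K x \<le> bertrand K (x + 1) - bertrand K x"
    and "bertrand K (x + 1) - bertrand K x \<le> bertrand_slope K (x + 1)"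
proof -
  have "\<exists>z>x. z < x + 1 \<and>
      bertrand K (x + 1) - bertrand K x = (x + 1 - x) * bertrand_slope K z"
    by (intro MVT2) (auto intro!: bertrand_has_derivative iter_ln_pos_mono[OF assms])
  then obtain z where z: "x < z" "z < x + 1"
    "bertrand K (x + 1) - bertrand K x = bertrand_slope K z" by auto
  show "bertrand_slope K x \<le> bertrand K (x + 1) - bertrand K x"
    unfolding z(3) using z by (intro bertrand_slope_mono[OF assms]) auto
  show "bertrand K (x + 1) - bertrand K x \<le> bertrand_slope K (x + 1)"
    unfolding z(3) using z by (intro bertrand_slope_mono iter_ln_pos_mono[OF assms]) auto
qed

text \<open>
  A second derivative is avoided by a multiplicative estimate: passing from \<open>x\<close> to \<open>x + 1\<close>
  multiplies \<open>x\<close> by \<open>1 + 1 / x\<close>, and as long as the iterated logarithms are at least 1,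
  each of them increases by a factor no larger than this. A product of at most \<open>K\<close> of them therefore increases by a relative amount of
  order \<open>1 / x\<close>, while the product itself is at most a power of \<open>ln x\<close>.
\<close>

lemma bertrand_slope_step_le:
  assumes ge1: "\<And>j. j \<le> K \<Longrightarrow> 1 \<le> (ln ^^ j) x" and "1 \<le> ln x"
  shows "bertrand_slope K (x + 1) - bertrand_slope K x \<le> real (Suc K) * 2 ^ K * (ln x ^ K / x)"
proof -
  have x: "1 \<le> x" using ge1[of 0] by simp
  have pos: "iter_ln_pos K x" using ge1 by (force simp: iter_ln_pos_iff)
  have step: "(ln ^^ j) (x + 1) \<le> (1 + 1 / x) * (ln ^^ j) x" if "j \<le> K" for j
    using that
  proof (induction j)
    case 0
    then show ?case using x by (simp add: field_simps)
  next
    case (Suc j)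
    have p: "0 < (ln ^^ j) x" "0 < (ln ^^ j) (x + 1)" using Suc.prems pos iter_ln_pos_mono[OF pos, of "x+1"]
      by (auto simp: iter_ln_pos_iff)
    have "(ln ^^ Suc j) (x + 1) \<le> ln ((1 + 1 / x) * (ln ^^ j) x)"
      using Suc p x by simp
    also have "\<dots> = ln (1 + 1 / x) + (ln ^^ Suc j) x"
      using p add_pos_pos[of 1 "1 / x"] x by (subst ln_mult_pos) auto
    also have "ln (1 + 1 / x) \<le> 1 / x * (ln ^^ Suc j) x"
    proof -
      have "ln (1 + 1 / x) \<le> 1 / x" using x by (intro ln_add_one_self_le_self) auto
      also have "\<dots> \<le> 1 / x * (ln ^^ Suc j) x"
        using ge1[OF Suc.prems] x by (simp add: divide_simps del: funpow.simps)
      finally show ?thesis .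
    qed
    finally show ?case by (simp add: algebra_simps)
  qed
  have le_ln: "(ln ^^ j) x \<le> ln x" if "0 < j" "j \<le> K" for j
    using that
  proof (induction j)
    case (Suc j)
    show ?case
    proof (cases "j = 0")
      case False
      then have "(ln ^^ Suc j) x \<le> (ln ^^ j) x"
        using pos Suc.prems ln_le_minus_one[of "(ln ^^ j) x"] by (auto simp: iter_ln_pos_iff)
      then show ?thesis using Suc False by simp
    qed simp
  qed simp
  \<comment> \<open>A crude substitute for \<open>(1 + y)\<^sup>m - 1 = O(y)\<close>, valid since \<open>y = 1 / x\<close> is at most 1.\<close>
  have power_bound: "(1 + y) ^ m - 1 \<le> 2 ^ m * y" if "0 \<le> y" "y \<le> 1" for y :: real and m :: nat
  proof (induction m)
    case (Suc m)
    have "(1 + y) ^ m \<le> 2 ^ m" using that by (intro power_mono) auto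
    then have "y * (1 + y) ^ m \<le> y * 2 ^ m" using that by (intro mult_left_mono)
    with Suc show ?case by (simp add: algebra_simps)
  qed (use that in simp)
  have term_bound: "(\<Prod>j\<in>{i<..K}. (ln ^^ j) (x + 1)) - (\<Prod>j\<in>{i<..K}. (ln ^^ j) x)
      \<le> 2 ^ K * (ln x ^ K / x)" if "i \<le> K" for i
  proof -
    let ?P = "\<lambda>x. \<Prod>j\<in>{i<..K}. (ln ^^ j) x"
    have P0: "0 \<le> ?P x" using pos by (intro prod_nonneg) (auto simp: iter_ln_pos_iff less_imp_le)
    have "?P (x + 1) \<le> (\<Prod>j\<in>{i<..K}. (1 + 1 / x) * (ln ^^ j) x)"
      using step iter_ln_pos_mono[OF pos, of "x+1"]
      by (intro prod_mono) (auto simp: iter_ln_pos_iff less_imp_le)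
    also have "\<dots> = (1 + 1 / x) ^ (K - i) * ?P x" by (simp add: prod.distrib)
    also have "\<dots> \<le> (1 + 1 / x) ^ K * ?P x"
      using x P0 by (intro mult_right_mono power_increasing) auto
    finally have "?P (x + 1) - ?P x \<le> ((1 + 1 / x) ^ K - 1) * ?P x" by (simp add: algebra_simps)
    also have "\<dots> \<le> (2 ^ K * (1 / x)) * ?P x"
      using P0 x by (intro mult_right_mono power_bound) auto
    also have "?P x \<le> (\<Prod>j\<in>{i<..K}. ln x)"
      using le_ln pos by (intro prod_mono) (auto simp: iter_ln_pos_iff less_imp_le)
    also have "\<dots> \<le> ln x ^ K" using assms(2) by (simp add: power_increasing)
    finally show ?thesis using x by (simp add: mult_left_mono divide_right_mono)
  qed
  have "bertrand_slope K (x + 1) - bertrand_slope K x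
      = (\<Sum>i\<le>K. (\<Prod>j\<in>{i<..K}. (ln ^^ j) (x + 1)) - (\<Prod>j\<in>{i<..K}. (ln ^^ j) x))"
    by (simp add: bertrand_slope_def sum_subtractf)
  also have "\<dots> \<le> (\<Sum>i\<le>K. 2 ^ K * (ln x ^ K / x))"
    by (intro sum_mono term_bound) simp
  finally show ?thesis by (simp add: mult.assoc)
qed

text \<open>
  Convexity is asymptotically negligible. Thus any constant \<open>c > 1\<close> in the last term of the
  ratio condition leaves a positive margin in Kummer's test.
\<close>

lemma bertrand_almost_affine:
  assumes "0 < \<epsilon>"
  shows "eventually (\<lambda>n. bertrand K (real n + 1) \<le> bertrand K (real n) + bertrand_slope K (real n) + \<epsilon>)
           sequentially"
proof -
  have "(\<lambda>n::nat. real (Suc K) * 2 ^ K * (ln (real n) ^ K / real n)) \<longlonglongrightarrow> real (Suc K) * 2 ^ K * 0"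
    by (intro tendsto_mult_left) real_asymp
  then have "eventually (\<lambda>n::nat. real (Suc K) * 2 ^ K * (ln (real n) ^ K / real n) < \<epsilon>) sequentially"
    using assms by (intro order_tendstoD(2)) auto
  moreover note eventually_iter_ln_ge_1[of "Suc K"]
  ultimately show ?thesis
  proof eventually_elim
    case (elim n)
    have ge1: "1 \<le> (ln ^^ j) (real n)" if "j \<le> K" for j using elim(2) that by (meson le_SucI)
    have "ln (real n) \<ge> 1" using elim(2)[rule_format, of 1] by simp
    then have "bertrand_slope K (real n + 1) - bertrand_slope K (real n) \<le> \<epsilon>"
      using bertrand_slope_step_le[OF ge1] elim(1) by fastforce
    moreover have "iter_ln_pos K (real n)" using ge1 by (rule iter_ln_pos_if_ge_1)
    ultimately show ?case using bertrand_step_bounds(2)[of K "real n"] by linarith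
  qed
qed

section \<open>Ratio tests on the logarithmic scale\<close>

lemma not_summable_inverse_bertrand:
  "\<not> summable (\<lambda>n. 1 / bertrand K (real n))"
proof
  assume *: "summable (\<lambda>n. 1 / bertrand K (real n))"
  let ?l = "\<lambda>n. (ln ^^ Suc K) (real n)"
  from eventually_iter_ln_ge_1[of K]
  have "eventually (\<lambda>n. norm (?l (Suc n) - ?l n) \<le> 1 / bertrand K (real n)) sequentially"
  proof eventually_elim
    case (elim n)
    then have pos: "iter_ln_pos K (real n)" by (intro iter_ln_pos_if_ge_1) auto
    have "\<exists>z>real n. z < real n + 1 \<and>
        (ln ^^ Suc K) (real n + 1) - ?l n = (real n + 1 - real n) * (1 / bertrand K z)"
      by (intro MVT2) (auto intro!: iter_ln_has_derivative iter_ln_pos_mono[OF pos] simp del: funpow.simps)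
    then obtain z where z: "z > real n" "?l (Suc n) - ?l n = 1 / bertrand K z"
      by (auto simp: add.commute simp del: funpow.simps)
    have "0 < bertrand K (real n)" by (rule bertrand_pos[OF pos])
    moreover have "bertrand K (real n) \<le> bertrand K z"
      unfolding bertrand_def using z pos iter_ln_mono[OF pos, of z]
      by (intro prod_mono) (auto simp: iter_ln_pos_iff less_imp_le)
    ultimately show ?case unfolding z(2) by (simp add: frac_le)
  qed
  \<comment> \<open>The increments of the next iterated logarithm would be summable, which would make it converge.\<close>
  then have "summable (\<lambda>n. ?l (Suc n) - ?l n)"
    using * by (rule summable_comparison_test_ev)
  then have "convergent (\<lambda>n. \<Sum>i<n. ?l (Suc i) - ?l i)"
    by (simp add: summable_iff_convergent del: funpow.simps)
  then have "convergent (\<lambda>n. ?l n - ?l 0)"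
    by (subst (asm) sum_lessThan_telescope)
  then obtain a where "(\<lambda>n. ?l n - ?l 0) \<longlonglongrightarrow> a" by (auto simp: convergent_def)
  then have "(\<lambda>n. ?l n - ?l 0 + ?l 0) \<longlonglongrightarrow> a + ?l 0" by (intro tendsto_intros)
  then have "?l \<longlonglongrightarrow> a + ?l 0" by (simp del: funpow.simps)
  with filterlim_iter_ln[of "Suc K"] show False
    using not_tendsto_and_filterlim_at_infinity[OF _ _ filterlim_at_top_imp_at_infinity]
    by (metis sequentially_bot)
qed

text \<open>
  Kummer's test with the weights \<open>bertrand K (n + 1)\<close>: the weighted ratio exceeds the
  weight plus its slope by \<open>c - 1\<close>, and the next weight exceeds the same quantity by
  arbitrarily little.
\<close>

lemma bertrand_test_convergence:
  fixes r :: "nat \<Rightarrow> real"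
  assumes r: "\<And>n. 0 < r n" and "1 < c"
    and ratio: "eventually (\<lambda>n. r n / r (Suc n) \<ge>
      1 + (\<Sum>i<K. 1 / bertrand i (real (Suc n))) + c / bertrand K (real (Suc n))) sequentially"
  shows "summable r"
proof -
  let ?p = "\<lambda>n. bertrand K (real (Suc n))"
  note pos = eventually_iter_ln_pos[of K]
  \<comment> \<open>Half of the margin absorbs the convexity of the weights, the other half is left to Kummer's test.\<close>
  define \<epsilon> where "\<epsilon> = (c - 1) / 2"
  have \<epsilon>: "0 < \<epsilon>" using assms by (simp add: \<epsilon>_def)
  have "eventually (\<lambda>n. ereal \<epsilon> \<le> ereal (?p n * r n / r (Suc n) - ?p (Suc n))) sequentially"
    using pos ratio eventually_sequentially_Suc[THEN iffD2, OF bertrand_almost_affine[OF \<epsilon>, of K]]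
  proof eventually_elim
    case (elim n)
    note b = bertrand_pos[OF elim(1)]
    have "?p n + bertrand_slope K (real (Suc n)) + (c - 1)
        = ?p n * (1 + (\<Sum>i<K. 1 / bertrand i (real (Suc n))) + c / ?p n)"
      unfolding bertrand_slope_eq[OF elim(1)] lessThan_Suc_atMost[symmetric] sum.lessThan_Suc
      using b by (simp add: field_simps)
    also have "\<dots> \<le> ?p n * (r n / r (Suc n))" using elim(2) b by (intro mult_left_mono) auto
    finally have "?p n + bertrand_slope K (real (Suc n)) + (c - 1) \<le> ?p n * r n / r (Suc n)" by simp
    moreover have "?p (Suc n) \<le> ?p n + bertrand_slope K (real (Suc n)) + \<epsilon>"
      using elim(3) by (simp add: add.commute)
    moreover have "c - 1 = \<epsilon> + \<epsilon>" by (simp add: \<epsilon>_def)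
    ultimately show ?case by (simp only: ereal_less_eq)
  qed
  then have "ereal \<epsilon> \<le> liminf (\<lambda>n. ereal (?p n * r n / r (Suc n) - ?p (Suc n)))"
    by (rule Liminf_bounded)
  moreover have "0 < ereal \<epsilon>" using \<epsilon> by simp
  ultimately have "0 < liminf (\<lambda>n. ereal (?p n * r n / r (Suc n) - ?p (Suc n)))"
    by (rule less_le_trans[rotated])
  then show ?thesis
    using r pos by (intro kummers_test_convergence[of r ?p])
      (auto elim!: eventually_mono intro: bertrand_pos less_imp_le)
qed

text \<open>
  The margin of Kummer's test is zero here, but convexity gives the exact inequality that makes
  \<open>bertrand K (n + 1) * r n\<close> eventually increasing. Hence \<open>r n\<close> dominates a multiple of a
  divergent series.
\<close>

lemma bertrand_test_divergence:
  fixes r :: "nat \<Rightarrow> real"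
  assumes r: "\<And>n. 0 < r n"
    and ratio: "eventually (\<lambda>n. r n / r (Suc n) \<le> 1 + (\<Sum>i\<le>K. 1 / bertrand i (real (Suc n)))) sequentially"
  shows "\<not> summable r"
proof
  assume sum: "summable r"
  let ?p = "\<lambda>n. bertrand K (real (Suc n))"
  note pos = eventually_iter_ln_pos[of K]
  obtain N where N: "\<And>n. n \<ge> N \<Longrightarrow> iter_ln_pos K (real (Suc n))"
    "\<And>n. n \<ge> N \<Longrightarrow> r n / r (Suc n) \<le> 1 + (\<Sum>i\<le>K. 1 / bertrand i (real (Suc n)))"
    using eventually_conj[OF pos ratio] by (auto simp: eventually_sequentially)
  have step: "?p n * r n \<le> ?p (Suc n) * r (Suc n)" if n: "n \<ge> N" for n
  proof -
    note b = bertrand_pos[OF N(1)[OF n]]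
    have "?p n * (r n / r (Suc n)) \<le> ?p n * (1 + (\<Sum>i\<le>K. 1 / bertrand i (real (Suc n))))"
      using b N(2)[OF n] by (intro mult_left_mono) auto
    also have "\<dots> = ?p n + bertrand_slope K (real (Suc n))"
      unfolding bertrand_slope_eq[OF N(1)[OF n]] by (simp add: algebra_simps)
    also have "\<dots> \<le> ?p (Suc n)" using bertrand_step_bounds(1)[OF N(1)[OF n]] by (simp add: add.commute)
    finally show ?thesis using r[of "Suc n"] by (simp add: field_simps)
  qed
  define C where "C = ?p N * r N"
  have C: "0 < C" unfolding C_def using bertrand_pos[OF N(1)] r by simp
  have le: "C \<le> ?p n * r n" if "n \<ge> N" for n
    using that by (induction rule: dec_induct) (use step in \<open>auto simp: C_def intro: order_trans\<close>)
  have "norm (1 / ?p n) \<le> r n / C" if "n \<ge> N" for n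
    using le[OF that] C bertrand_pos[OF N(1)[OF that]] by (simp add: field_simps)
  then have "summable (\<lambda>n. 1 / ?p n)"
    by (intro summable_comparison_test[OF _ summable_divide[OF sum]]) auto
  then have "summable (\<lambda>n. 1 / bertrand K (real n))"
    using summable_Suc_iff[of "\<lambda>n. 1 / bertrand K (real n)"] by simp
  then show False using not_summable_inverse_bertrand by blast
qed

section \<open>Harmonic functions of the jump chain\<close>

definition jump_prob :: "(nat \<Rightarrow> real) \<Rightarrow> (nat \<Rightarrow> real) \<Rightarrow> nat \<Rightarrow> nat \<Rightarrow> real" where
  "jump_prob birth death x y = bd_rate birth death x y / bd_exit_rate birth death x"

text \<open>
  The probability that the chain started in \<open>x\<close> is not in 0 at any of the times \<open>0, \<dots>, N\<close>,
  given by first-step analysis. Working with this recursion reduces the dichotomy to real sequences.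
\<close>

primrec avoid :: "(nat \<Rightarrow> real) \<Rightarrow> (nat \<Rightarrow> real) \<Rightarrow> nat \<Rightarrow> nat \<Rightarrow> real" where
  "avoid birth death 0 x = of_bool (x \<noteq> 0)"
| "avoid birth death (Suc N) x = (if x = 0 then 0
     else jump_prob birth death x (Suc x) * avoid birth death N (Suc x)
        + jump_prob birth death x (x - 1) * avoid birth death N (x - 1))"

text \<open>
  Increments of the scale function \<open>x \<mapsto> (\<Sum>k<x. scale_inc birth death k)\<close>, which vanishes in 0
  and is harmonic for the jump chain away from 0.
\<close>

definition scale_inc :: "(nat \<Rightarrow> real) \<Rightarrow> (nat \<Rightarrow> real) \<Rightarrow> nat \<Rightarrow> real" where
  "scale_inc birth death k = (\<Prod>i=1..k. death i / birth i)"

definition nbrs :: "nat \<Rightarrow> nat set" where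
  "nbrs x = (if x = 0 then {1} else {Suc x, x - 1})"

locale bd_rates =
  fixes birth death :: "nat \<Rightarrow> real"
  assumes birth_pos: "\<And>n. 0 < birth n"
    and death_pos: "\<And>n. 1 \<le> n \<Longrightarrow> 0 < death n"
begin

abbreviation "p \<equiv> jump_prob birth death"
abbreviation "u \<equiv> avoid birth death"
abbreviation "r \<equiv> scale_inc birth death"

lemma jump_prob_0: "p 0 y = of_bool (y = 1)"
  using birth_pos[of 0] by (auto simp: jump_prob_def bd_rate_def bd_exit_rate_def)

lemma jump_prob_up: "1 \<le> x \<Longrightarrow> p x (Suc x) = birth x / (birth x + death x)"
  and jump_prob_down: "1 \<le> x \<Longrightarrow> p x (x - 1) = death x / (birth x + death x)"
  by (auto simp: jump_prob_def bd_rate_def bd_exit_rate_def)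

lemma jump_prob_sum: "1 \<le> x \<Longrightarrow> p x (Suc x) + p x (x - 1) = 1"
  using birth_pos[of x] death_pos[of x]
  by (simp add: jump_prob_up jump_prob_down add_divide_distrib[symmetric] del: One_nat_def)

lemma jump_prob_nonneg: "0 \<le> p x y"
  unfolding jump_prob_def bd_rate_def bd_exit_rate_def
  using birth_pos[of x] death_pos[of x] by (auto intro!: divide_nonneg_nonneg add_nonneg_nonneg less_imp_le)

lemma scale_inc_pos: "0 < r k"
  unfolding scale_inc_def by (intro prod_pos) (simp add: birth_pos death_pos)

lemma scale_inc_ratio: "r n / r (Suc n) = birth (Suc n) / death (Suc n)"
proof -
  have "r (Suc n) = r n * (death (Suc n) / birth (Suc n))" by (simp add: scale_inc_def)
  then show ?thesis using scale_inc_pos[of n] by simp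
qed

lemma scale_harmonic:
  assumes "1 \<le> x"
  shows "p x (Suc x) * sum r {..<Suc x} + p x (x - 1) * sum r {..<x - 1} = sum r {..<x}"
proof -
  obtain y where y: "x = Suc y" using assms by (cases x) auto
  have "birth x * r x = death x * r y"
    using scale_inc_ratio[of y] scale_inc_pos[of x] death_pos[of x] y by (simp add: field_simps)
  then have "birth x * sum r {..<Suc x} + death x * sum r {..<y} = (birth x + death x) * sum r {..<x}"
    by (simp add: y algebra_simps)
  moreover have "birth x + death x \<noteq> 0" using birth_pos[of x] death_pos[of x] assms by simp
  ultimately have "(birth x * sum r {..<Suc x} + death x * sum r {..<y}) / (birth x + death x) = sum r {..<x}"
    by simp
  then show ?thesis
    unfolding jump_prob_up[OF assms] jump_prob_down[OF assms] by (simp add: y add_divide_distrib)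
qed

lemma avoid_nonneg: "0 \<le> u N x"
  by (induction N arbitrary: x) (auto simp: jump_prob_nonneg)

lemma avoid_decreasing: "u (Suc N) x \<le> u N x"
proof (induction N arbitrary: x)
  case 0
  then show ?case using jump_prob_sum[of x] jump_prob_nonneg[of x "x - 1"] by auto
next
  case (Suc N)
  then show ?case by (auto simp del: avoid.simps(2) simp: avoid.simps(2)[of _ _ _ x]
        intro!: add_mono mult_left_mono jump_prob_nonneg)
qed

lemma avoid_le_1: "u N x \<le> 1"
proof (induction N)
  case (Suc N)
  then show ?case using avoid_decreasing[of N x] by linarith
qed simp

text \<open>
  The scale function divided by its supremum is harmonic away from 0, vanishes in 0 and is at most 1
  elsewhere; first-step analysis preserves this bound. At 1 it bounds the avoidance
  probability away from zero uniformly in \<open>N\<close>.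
\<close>

lemma avoid_ge_scale:
  assumes "summable r"
  shows "sum r {..<x} / suminf r \<le> u N x"
proof (induction N arbitrary: x)
  case 0
  have "sum r {..<x} \<le> suminf r"
    using assms less_imp_le[OF scale_inc_pos] by (intro sum_le_suminf) auto
  moreover have "0 < suminf r" using assms scale_inc_pos by (rule suminf_pos)
  ultimately show ?case by (auto simp: divide_le_eq simp del: sum.lessThan_Suc)
next
  case (Suc N)
  show ?case
  proof (cases "x = 0")
    case False
    then have "sum r {..<x} / suminf r = p x (Suc x) * (sum r {..<Suc x} / suminf r)
        + p x (x - 1) * (sum r {..<x - 1} / suminf r)"
      by (subst scale_harmonic[symmetric]) (auto simp: add_divide_distrib simp del: sum.lessThan_Suc)
    also have "\<dots> \<le> u (Suc N) x"
      using False Suc by (auto intro!: add_mono mult_left_mono jump_prob_nonneg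
          simp del: sum.lessThan_Suc times_divide_eq_right)
    finally show ?thesis .
  qed simp
qed

text \<open>
  The limit of the avoidance probabilities is harmonic away from 0 and vanishes in 0, so it is a
  multiple of the scale function. It is also bounded, and an unbounded scale function leaves only
  the multiple zero.
\<close>

lemma avoid_tendsto_0:
  assumes "\<not> summable r"
  shows "(\<lambda>N. u N 1) \<longlonglongrightarrow> 0"
proof -
  define v where "v x = lim (\<lambda>N. u N x)" for x
  have lim: "(\<lambda>N. u N x) \<longlonglongrightarrow> v x" for x
  proof -
    have "decseq (\<lambda>N. u N x)" using avoid_decreasing by (rule decseq_SucI)
    then have "convergent (\<lambda>N. u N x)"
      using decseq_convergent[of "\<lambda>N. u N x" 0] avoid_nonneg by (metis convergent_def)
    then show ?thesis unfolding v_def by (rule convergent_LIMSEQ_iff[THEN iffD1])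
  qed
  have v01: "0 \<le> v x" "v x \<le> 1" for x
    using lim avoid_nonneg avoid_le_1
    by (auto intro: LIMSEQ_le_const[OF lim] LIMSEQ_le_const2[OF lim])
  have v0: "v 0 = 0"
  proof -
    have "(\<lambda>N. u (Suc N) 0) \<longlonglongrightarrow> v 0" using lim by (rule LIMSEQ_Suc)
    then show ?thesis by (simp add: LIMSEQ_const_iff)
  qed
  have harm: "v x = p x (Suc x) * v (Suc x) + p x (x - 1) * v (x - 1)" if "1 \<le> x" for x
  proof -
    have "(\<lambda>N. u (Suc N) x) \<longlonglongrightarrow> p x (Suc x) * v (Suc x) + p x (x - 1) * v (x - 1)"
      using that by (auto intro!: tendsto_intros lim)
    moreover have "(\<lambda>N. u (Suc N) x) \<longlonglongrightarrow> v x" using lim by (rule LIMSEQ_Suc)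
    ultimately show ?thesis using LIMSEQ_unique by blast
  qed
  have inc: "v (Suc x) - v x = v 1 * r x" for x
  proof (induction x)
    case 0
    then show ?case by (simp add: v0 scale_inc_def)
  next
    case (Suc x)
    let ?b = "birth (Suc x)" and ?d = "death (Suc x)"
    have pos: "0 < ?b" "0 < ?d" by (simp_all add: birth_pos death_pos)
    have "v (Suc x) = ?b / (?b + ?d) * v (Suc (Suc x)) + ?d / (?b + ?d) * v x"
      using harm[of "Suc x"] jump_prob_up[of "Suc x"] jump_prob_down[of "Suc x"] by simp
    also have "\<dots> = (?b * v (Suc (Suc x)) + ?d * v x) / (?b + ?d)"
      by (simp add: add_divide_distrib)
    finally have "v (Suc x) * (?b + ?d) = ?b * v (Suc (Suc x)) + ?d * v x"
      using pos by (simp add: eq_divide_eq)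
    then have "?b * (v (Suc (Suc x)) - v (Suc x)) = ?d * (v 1 * r x)"
      unfolding Suc[symmetric] by (simp add: algebra_simps)
    moreover have "?b * r (Suc x) = ?d * r x"
      using scale_inc_ratio[of x] scale_inc_pos[of "Suc x"] pos by (simp add: field_simps)
    ultimately have "?b * (v (Suc (Suc x)) - v (Suc x)) = ?b * (v 1 * r (Suc x))"
      by (simp add: algebra_simps)
    then show ?case using pos by simp
  qed
  have v_eq: "v x = v 1 * sum r {..<x}" for x
  proof (induction x)
    case (Suc x)
    then show ?case using inc[of x] by (simp add: algebra_simps)
  qed (simp add: v0)
  have "v 1 = 0"
  proof (rule ccontr)
    assume "v 1 \<noteq> 0"
    then have "0 < v 1" using v01(1)[of 1] by simp
    then have "sum r {..<x} \<le> 1 / v 1" for x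
      using v01(2)[of x] v_eq[of x] by (simp add: field_simps)
    then have "summable r"
      using scale_inc_pos by (intro summableI_nonneg_bounded[of _ "1 / v 1"]) (auto intro: less_imp_le)
    with assms show False by simp
  qed
  with lim[of 1] show ?thesis by simp
qed

end

section \<open>Returns of the process and zeros of its jump chain\<close>

lemma jump_process_eq:
  assumes pos: "\<And>i. 0 < S i \<omega>" and "(\<Sum>i<n. S i \<omega>) \<le> t" "t < (\<Sum>i\<le>n. S i \<omega>)"
  shows "jump_process Y S t \<omega> = Some (Y n \<omega>)"
proof -
  have "(LEAST n. t < (\<Sum>i\<le>n. S i \<omega>)) = n"
  proof (rule Least_equality)
    fix m assume m: "t < (\<Sum>i\<le>m. S i \<omega>)"
    show "n \<le> m"
    proof (rule ccontr)
      assume "\<not> n \<le> m"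
      then have "(\<Sum>i\<le>m. S i \<omega>) \<le> (\<Sum>i<n. S i \<omega>)"
        by (intro sum_mono2) (auto intro: less_imp_le[OF pos])
      with m assms show False by simp
    qed
  qed (fact assms)
  then show ?thesis using assms by (auto simp: jump_process_def)
qed

text \<open>
  Positive holding times make the process visit every state of the jump chain on a nondegenerate
  time interval. A return at the \<open>m\<close>-th jump is seen at the jump time itself, the first holding
  time serving as an earlier time spent outside 0.
\<close>

lemma returns_to_0_iff:
  assumes pos: "\<And>i. 0 < S i \<omega>" and X: "\<And>t. 0 \<le> t \<Longrightarrow> X t \<omega> = jump_process Y S t \<omega>"
    and Y: "Y 0 \<omega> = 0" "Y 1 \<omega> \<noteq> 0"
  shows "returns_to_0 X \<omega> \<longleftrightarrow> (\<exists>m\<ge>1. Y m \<omega> = 0)"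
proof
  assume "\<exists>m\<ge>1. Y m \<omega> = 0"
  then obtain m where m: "m \<ge> 1" "Y m \<omega> = 0" by auto
  with Y have m2: "m \<ge> 2" by (cases "m = 1") auto
  let ?s = "S 0 \<omega>" and ?t = "\<Sum>i<m. S i \<omega>"
  have "X ?s \<omega> = Some (Y 1 \<omega>)" "X ?t \<omega> = Some (Y m \<omega>)"
    using pos by (auto simp: X less_imp_le sum_nonneg lessThan_Suc_atMost[symmetric] intro!: jump_process_eq)
  moreover have "?s < ?t"
  proof -
    have "?s < (\<Sum>i<2. S i \<omega>)" using pos[of 1] by (simp add: numeral_2_eq_2)
    also have "\<dots> \<le> ?t" using m2 by (intro sum_mono2) (auto intro: less_imp_le[OF pos])
    finally show ?thesis .
  qed
  ultimately show "returns_to_0 X \<omega>"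
    unfolding returns_to_0_def using m Y less_imp_le[OF pos[of 0]]
    by (intro exI[of _ ?s] exI[of _ ?t]) simp
next
  assume "returns_to_0 X \<omega>"
  then obtain s t where st: "0 \<le> s" "s < t" "X s \<omega> \<noteq> Some 0" "X t \<omega> = Some 0"
    by (auto simp: returns_to_0_def)
  let ?L = "\<lambda>t. LEAST n. t < (\<Sum>i\<le>n. S i \<omega>)"
  have t: "t < (\<Sum>i\<le>?L t. S i \<omega>)" "Y (?L t) \<omega> = 0"
    using st X[of t] by (auto simp: jump_process_def split: if_splits intro: LeastI)
  then have "s < (\<Sum>i\<le>?L t. S i \<omega>)" using st by simp
  then have "X s \<omega> = Some (Y (?L s) \<omega>)" "?L s \<le> ?L t"
    using X[of s] st by (auto simp: jump_process_def intro: Least_le)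
  with st(3) t(2) have "?L t \<noteq> ?L s" by auto
  with \<open>?L s \<le> ?L t\<close> have "1 \<le> ?L t" by linarith
  with t show "\<exists>m\<ge>1. Y m \<omega> = 0" by blast
qed

section \<open>The law of the jump chain\<close>

locale bd_paths = bd_rates + prob_space M for M :: "'a measure" +
  fixes Y :: "nat \<Rightarrow> 'a \<Rightarrow> nat" and S :: "nat \<Rightarrow> 'a \<Rightarrow> real"
  assumes jumps_holding: "bd_jumps_holding M birth death Y S"
begin

lemma measurable_Y [measurable]: "Y n \<in> measurable M (count_space UNIV)"
  and measurable_S [measurable]: "S n \<in> borel_measurable M"
  using jumps_holding by (auto simp: bd_jumps_holding_def)

definition path_weight :: "(nat \<Rightarrow> nat) \<Rightarrow> nat \<Rightarrow> real" where
  "path_weight y n = of_bool (y 0 = 0) * (\<Prod>i<n. p (y i) (y (Suc i)))"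

lemma prob_path_pos_holding:
  "prob {\<omega> \<in> space M. \<forall>i\<le>n. Y i \<omega> = y i \<and> 0 < S i \<omega>} = path_weight y n"
  using jumps_holding[unfolded bd_jumps_holding_def, THEN conjunct2, THEN conjunct2,
      rule_format, of n "\<lambda>_. 0" y]
  by (simp add: path_weight_def jump_prob_def)

lemma path_weight_upd: "path_weight (y(Suc n := z)) (Suc n) = path_weight y n * p (y n) z"
proof -
  have "(\<Prod>i<n. p ((y(Suc n := z)) i) ((y(Suc n := z)) (Suc i))) = (\<Prod>i<n. p (y i) (y (Suc i)))"
    by (intro prod.cong) auto
  then show ?thesis by (simp add: path_weight_def mult.assoc del: fun_upd_apply) simp
qed

lemma sum_jump_prob_nbrs: "(\<Sum>z\<in>nbrs x. p x z) = 1"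
  using jump_prob_sum[of x] by (auto simp: nbrs_def jump_prob_0)

text \<open>
  The cylinders that continue a given path to a neighbour have total probability equal to that of
  the path itself, so the remaining continuations form a null set.
\<close>

lemma AE_next_jump:
  "AE \<omega> in M. (\<forall>i\<le>n. Y i \<omega> = y i \<and> 0 < S i \<omega>) \<longrightarrow> Y (Suc n) \<omega> \<in> nbrs (y n) \<and> 0 < S (Suc n) \<omega>"
proof -
  define A where "A y n = {\<omega> \<in> space M. \<forall>i\<le>n. Y i \<omega> = y i \<and> 0 < S i \<omega>}" for y n
  have [measurable]: "A y n \<in> sets M" for y n unfolding A_def by measurable
  let ?B = "\<Union>z\<in>nbrs (y n). A (y(Suc n := z)) (Suc n)"
  have fin: "finite (nbrs (y n))" by (simp add: nbrs_def)
  have sub: "?B \<subseteq> A y n" by (fastforce simp: A_def le_Suc_eq)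
  have "disjoint_family_on (\<lambda>z. A (y(Suc n := z)) (Suc n)) (nbrs (y n))"
    by (auto simp: disjoint_family_on_def A_def)
  then have "prob ?B = (\<Sum>z\<in>nbrs (y n). prob (A (y(Suc n := z)) (Suc n)))"
    using fin by (intro finite_measure_finite_Union) auto
  also have "\<dots> = path_weight y n * (\<Sum>z\<in>nbrs (y n). p (y n) z)"
    by (simp add: A_def prob_path_pos_holding path_weight_upd sum_distrib_left del: fun_upd_apply)
  also have "\<dots> = prob (A y n)" by (simp add: sum_jump_prob_nbrs A_def prob_path_pos_holding)
  finally have "prob (A y n - ?B) = 0" using fin sub by (subst finite_measure_Diff) auto
  then have "AE \<omega> in M. \<omega> \<notin> A y n - ?B"
    using fin by (subst (asm) prob_eq_0) auto
  then show ?thesis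
    by (rule AE_mp) (auto intro!: AE_I2 simp: A_def le_Suc_eq)
qed


lemma AE_Y_0: "AE \<omega> in M. Y 0 \<omega> = 0 \<and> 0 < S 0 \<omega>"
proof -
  have "prob {\<omega> \<in> space M. Y 0 \<omega> = 0 \<and> 0 < S 0 \<omega>} = 1"
    using prob_path_pos_holding[of 0 "\<lambda>_. 0"] by (simp add: path_weight_def)
  then show ?thesis by (subst (asm) prob_Collect_eq_1) auto
qed

text \<open>
  Finite paths are coded as lists, of which there are only countably many. This allows
  one exceptional null set for all of them.
\<close>

lemma AE_all_paths:
  "AE \<omega> in M. Y 0 \<omega> = 0 \<and> (\<forall>n. 0 < S n \<omega>) \<and> (\<forall>n. Y (Suc n) \<omega> \<in> nbrs (Y n \<omega>))"
proof -
  have "AE \<omega> in M. \<forall>xs n. (\<forall>i\<le>n. Y i \<omega> = xs ! i \<and> 0 < S i \<omega>) \<longrightarrow>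
      Y (Suc n) \<omega> \<in> nbrs (xs ! n) \<and> 0 < S (Suc n) \<omega>"
    unfolding AE_all_countable using AE_next_jump by blast
  with AE_Y_0 show ?thesis
  proof eventually_elim
    case (elim \<omega>)
    have next_jump: "Y (Suc n) \<omega> \<in> nbrs (Y n \<omega>) \<and> 0 < S (Suc n) \<omega>" if "\<forall>i\<le>n. 0 < S i \<omega>" for n
      using elim(2)[rule_format, of n "map (\<lambda>i. Y i \<omega>) [0..<Suc n]"] that
      by (simp add: nth_map del: upt_Suc)
    have "\<forall>i\<le>n. 0 < S i \<omega>" for n
      by (induction n) (use elim(1) next_jump in \<open>auto simp: le_Suc_eq\<close>)
    with elim(1) next_jump show ?case by blast
  qed
qed

lemma prob_path: "prob {\<omega> \<in> space M. \<forall>i\<le>n. Y i \<omega> = y i} = path_weight y n"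
  unfolding prob_path_pos_holding[symmetric]
proof (rule finite_measure_eq_AE)
  show "AE \<omega> in M. (\<omega> \<in> {\<omega> \<in> space M. \<forall>i\<le>n. Y i \<omega> = y i}) =
      (\<omega> \<in> {\<omega> \<in> space M. \<forall>i\<le>n. Y i \<omega> = y i \<and> 0 < S i \<omega>})"
    using AE_all_paths by eventually_elim auto
qed measurable

text \<open>
  First-step analysis for the actual chain: conditioning on an initial path reduces to its two
  possible continuations. The arbitrary initial path is what makes the induction on \<open>N\<close> work, and it
  takes the place of the Markov property.
\<close>

lemma prob_path_avoid:
  "prob {\<omega> \<in> space M. (\<forall>i\<le>n. Y i \<omega> = y i) \<and> (\<forall>i\<in>{n..n + N}. Y i \<omega> \<noteq> 0)} = path_weight y n * u N (y n)"
proof (induction N arbitrary: n y)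
  case 0
  show ?case
  proof (cases "y n = 0")
    case False
    then have "{\<omega> \<in> space M. (\<forall>i\<le>n. Y i \<omega> = y i) \<and> (\<forall>i\<in>{n..n + 0}. Y i \<omega> \<noteq> 0)}
        = {\<omega> \<in> space M. \<forall>i\<le>n. Y i \<omega> = y i}" by auto
    with False show ?thesis by (simp add: prob_path)
  next
    case True
    then have "{\<omega> \<in> space M. (\<forall>i\<le>n. Y i \<omega> = y i) \<and> (\<forall>i\<in>{n..n + 0}. Y i \<omega> \<noteq> 0)} = {}" by auto
    with True show ?thesis by (simp only: measure_empty) simp
  qed
next
  case (Suc N)
  define E where "E y n N = {\<omega> \<in> space M. (\<forall>i\<le>n. Y i \<omega> = y i) \<and> (\<forall>i\<in>{n..n + N}. Y i \<omega> \<noteq> 0)}" for y n N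
  have [measurable]: "E y n N \<in> sets M" for y n N unfolding E_def by measurable
  have IH: "prob (E y n N) = path_weight y n * u N (y n)" for y n
    using Suc by (simp add: E_def)
  have "prob (E y n (Suc N)) = path_weight y n * u (Suc N) (y n)"
  proof (cases "y n = 0")
    case True
    have "\<omega> \<notin> E y n (Suc N)" for \<omega>
    proof
      assume "\<omega> \<in> E y n (Suc N)"
      then have "Y n \<omega> = y n" "\<forall>i\<in>{n..n + Suc N}. Y i \<omega> \<noteq> 0"
        unfolding E_def by auto
      moreover from this(2) have "Y n \<omega> \<noteq> 0" by (rule bspec) simp
      ultimately have "y n \<noteq> 0" by simp
      with True show False by simp
    qed
    then have "E y n (Suc N) = {}" by blast
    with True show ?thesis by simp
  next
    case False
    let ?E = "\<lambda>z. E (y(Suc n := z)) (Suc n) N"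
    have eq: "(\<omega> \<in> E y n (Suc N)) = (\<omega> \<in> ?E (Suc (y n)) \<union> ?E (y n - 1))"
      if "Y (Suc n) \<omega> \<in> nbrs (Y n \<omega>)" for \<omega>
    proof -
      have "{n..n + Suc N} = insert n {Suc n..Suc n + N}" by auto
      then show ?thesis
        using that False by (auto simp: E_def nbrs_def le_Suc_eq simp del: atLeastAtMost_iff)
    qed
    have "prob (E y n (Suc N)) = prob (?E (Suc (y n)) \<union> ?E (y n - 1))"
    proof (rule finite_measure_eq_AE)
      show "AE \<omega> in M. (\<omega> \<in> E y n (Suc N)) = (\<omega> \<in> ?E (Suc (y n)) \<union> ?E (y n - 1))"
        using AE_all_paths by eventually_elim (intro eq; blast)
    qed auto
    also have "\<dots> = prob (?E (Suc (y n))) + prob (?E (y n - 1))"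
      by (intro finite_measure_Union) (auto simp: E_def)
    also have "\<dots> = path_weight y n * u (Suc N) (y n)"
      unfolding IH path_weight_upd using False by (simp add: algebra_simps)
    finally show ?thesis .
  qed
  then show ?case by (simp only: E_def)
qed

text \<open>
  Almost every path begins with 0, 1, so the previous lemma applies to this initial path.
\<close>

lemma prob_avoid: "prob {\<omega> \<in> space M. \<forall>i\<in>{1..Suc N}. Y i \<omega> \<noteq> 0} = u N 1"
proof -
  \<comment> \<open>The identity is a convenient choice of a path that begins with 0, 1.\<close>
  let ?y = "\<lambda>i. i :: nat"
  have "prob {\<omega> \<in> space M. \<forall>i\<in>{1..Suc N}. Y i \<omega> \<noteq> 0}
      = prob {\<omega> \<in> space M. (\<forall>i\<le>1. Y i \<omega> = ?y i) \<and> (\<forall>i\<in>{1..1 + N}. Y i \<omega> \<noteq> 0)}"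
  proof (rule finite_measure_eq_AE)
    show "AE \<omega> in M. (\<omega> \<in> {\<omega> \<in> space M. \<forall>i\<in>{1..Suc N}. Y i \<omega> \<noteq> 0}) =
        (\<omega> \<in> {\<omega> \<in> space M. (\<forall>i\<le>1. Y i \<omega> = ?y i) \<and> (\<forall>i\<in>{1..1 + N}. Y i \<omega> \<noteq> 0)})"
      using AE_all_paths
    proof eventually_elim
      case (elim \<omega>)
      then have "Y (Suc 0) \<omega> \<in> nbrs 0" by metis
      with elim show ?case by (auto simp: nbrs_def le_Suc_eq)
    qed
  qed measurable
  also have "\<dots> = u N 1"
    unfolding prob_path_avoid by (simp add: path_weight_def jump_prob_0)
  finally show ?thesis .
qed

lemma prob_never_return:
  "(\<lambda>N. u N 1) \<longlonglongrightarrow> prob {\<omega> \<in> space M. \<forall>m\<ge>1. Y m \<omega> \<noteq> 0}"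
proof -
  let ?E = "\<lambda>N. {\<omega> \<in> space M. \<forall>i\<in>{1..Suc N}. Y i \<omega> \<noteq> 0}"
  have "(\<lambda>N. prob (?E N)) \<longlonglongrightarrow> prob (\<Inter>N. ?E N)"
    by (intro finite_Lim_measure_decseq) (auto simp: decseq_def)
  moreover have "(\<Inter>N. ?E N) = {\<omega> \<in> space M. \<forall>m\<ge>1. Y m \<omega> \<noteq> 0}"
    by (auto simp: Suc_le_eq) (metis Suc_le_eq atLeastAtMost_iff le_SucI order_refl One_nat_def)+
  ultimately show ?thesis unfolding prob_avoid by simp
qed

text \<open>
  In the summable case the lower bound by the scale function is positive at 1, the first state
  visited after 0.
\<close>

lemma AE_return_iff:
  "(AE \<omega> in M. \<exists>m\<ge>1. Y m \<omega> = 0) \<longleftrightarrow> \<not> summable r"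
proof -
  have "(AE \<omega> in M. \<exists>m\<ge>1. Y m \<omega> = 0) \<longleftrightarrow> prob {\<omega> \<in> space M. \<forall>m\<ge>1. Y m \<omega> \<noteq> 0} = 0"
    by (subst prob_Collect_eq_0) auto
  also have "\<dots> \<longleftrightarrow> \<not> summable r"
  proof
    assume "prob {\<omega> \<in> space M. \<forall>m\<ge>1. Y m \<omega> \<noteq> 0} = 0"
    with prob_never_return have lim: "(\<lambda>N. u N 1) \<longlonglongrightarrow> 0" by simp
    show "\<not> summable r"
    proof
      assume sum: "summable r"
      then have "0 < suminf r" using scale_inc_pos by (rule suminf_pos)
      then have "0 < sum r {..<1} / suminf r" using scale_inc_pos[of 0] by simp
      moreover have "sum r {..<1} / suminf r \<le> 0"
        using avoid_ge_scale[OF sum] by (intro LIMSEQ_le_const[OF lim]) blast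
      ultimately show False by simp
    qed
  next
    assume "\<not> summable r"
    then show "prob {\<omega> \<in> space M. \<forall>m\<ge>1. Y m \<omega> \<noteq> 0} = 0"
      using LIMSEQ_unique[OF prob_never_return avoid_tendsto_0] by simp
  qed
  finally show ?thesis .
qed

end

lemma (in bd_rates) recurrent_iff_not_summable:
  assumes "birth_death_process M birth death X"
  shows "recurrent M X \<longleftrightarrow> \<not> summable r"
proof -
  obtain Y S where YS: "prob_space M" "bd_jumps_holding M birth death Y S"
    and X: "AE \<omega> in M. \<forall>t\<ge>0. X t \<omega> = jump_process Y S t \<omega>"
    using assms by (auto simp: birth_death_process_def)
  interpret bd_paths birth death M Y S
    using YS bd_rates_axioms by (intro bd_paths.intro bd_paths_axioms.intro)
  have "AE \<omega> in M. returns_to_0 X \<omega> \<longleftrightarrow> (\<exists>m\<ge>1. Y m \<omega> = 0)"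
    using AE_all_paths X
  proof eventually_elim
    case (elim \<omega>)
    then have "Y (Suc 0) \<omega> \<in> nbrs 0" by metis
    with elim show ?case by (intro returns_to_0_iff) (auto simp: nbrs_def)
  qed
  then have "recurrent M X \<longleftrightarrow> (AE \<omega> in M. \<exists>m\<ge>1. Y m \<omega> = 0)"
    unfolding recurrent_def by (intro iffI; elim AE_mp; auto elim!: eventually_mono)
  then show ?thesis by (simp only: AE_return_iff)
qed

section \<open>The recurrence criterion for birth-and-death processes\<close>

lemma log_ratio_bound_eq:
  "1 + 1 / x + 1 / x * (\<Sum>k=1..m. 1 / (\<Prod>j=1..k. (ln ^^ j) x)) = 1 + (\<Sum>i\<le>m. 1 / bertrand i x)"
proof -
  have "(\<Sum>i\<le>m. 1 / bertrand i x) = 1 / bertrand 0 x + (\<Sum>k=1..m. 1 / bertrand k x)"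
    unfolding atMost_atLeast0 by (simp add: sum.atLeast_Suc_atMost)
  then show ?thesis by (simp add: bertrand_eq sum_distrib_left)
qed

theorem theorem3:
  fixes M :: "'a measure"
    and birth death :: "nat \<Rightarrow> real"
    and X :: "real \<Rightarrow> 'a \<Rightarrow> nat option"
  assumes "\<And>n. 0 < birth n"
    and "\<And>n. 1 \<le> n \<Longrightarrow> 0 < death n"
    and "birth_death_process M birth death X"
  shows "((\<exists>(c::real) (K::nat) (n0::real). 1 < c \<and> 1 \<le> K \<and>
            (\<forall>n::nat. n0 < real n \<longrightarrow> iter_ln_pos K (real n)) \<and>
            (\<forall>n::nat. n0 < real n \<longrightarrow>
               birth n / death n \<ge>
                 1 + 1 / real n
                   + 1 / real n * (\<Sum>k=1..K-1. 1 / (\<Prod>j=1..k. (ln ^^ j) (real n)))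
                   + c / (real n * (\<Prod>j=1..K. (ln ^^ j) (real n)))))
          \<longrightarrow> transient M X)
       \<and> ((\<exists>(K::nat) (n0::real). 1 \<le> K \<and>
            (\<forall>n::nat. n0 < real n \<longrightarrow> iter_ln_pos K (real n)) \<and>
            (\<forall>n::nat. n0 < real n \<longrightarrow>
               birth n / death n \<le>
                 1 + 1 / real n
                   + 1 / real n * (\<Sum>i=1..K. 1 / (\<Prod>j=1..i. (ln ^^ j) (real n)))))
          \<longrightarrow> recurrent M X)"
proof (intro conjI impI)
  interpret bd_rates birth death
    using assms(1,2) by unfold_locales
  note criterion = recurrent_iff_not_summable[OF assms(3)]
  have large: "eventually (\<lambda>n. n0 < real (Suc n)) sequentially" for n0
    by real_asymp
  {
    assume "\<exists>(c::real) (K::nat) (n0::real). 1 < c \<and> 1 \<le> K \<and>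
            (\<forall>n::nat. n0 < real n \<longrightarrow> iter_ln_pos K (real n)) \<and>
            (\<forall>n::nat. n0 < real n \<longrightarrow>
               birth n / death n \<ge>
                 1 + 1 / real n
                   + 1 / real n * (\<Sum>k=1..K-1. 1 / (\<Prod>j=1..k. (ln ^^ j) (real n)))
                   + c / (real n * (\<Prod>j=1..K. (ln ^^ j) (real n))))"
    then obtain c :: real and K and n0 :: real where c: "1 < c" and K: "1 \<le> K"
      and bound: "\<And>n::nat. n0 < real n \<Longrightarrow>
        1 + (\<Sum>i\<le>K - 1. 1 / bertrand i (real n)) + c / bertrand K (real n) \<le> birth n / death n"
      unfolding log_ratio_bound_eq bertrand_eq[symmetric] by blast
    have "{..K - 1} = {..<K}" using K by auto
    then have "summable r"
      by (intro bertrand_test_convergence[OF _ c, where K = K] scale_inc_pos eventually_mono[OF large[of n0]])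
        (use bound in \<open>simp only: scale_inc_ratio\<close>)
    then show "transient M X" by (simp add: transient_def criterion)
  next
    assume "\<exists>(K::nat) (n0::real). 1 \<le> K \<and>
            (\<forall>n::nat. n0 < real n \<longrightarrow> iter_ln_pos K (real n)) \<and>
            (\<forall>n::nat. n0 < real n \<longrightarrow>
               birth n / death n \<le>
                 1 + 1 / real n
                   + 1 / real n * (\<Sum>i=1..K. 1 / (\<Prod>j=1..i. (ln ^^ j) (real n))))"
    then obtain K and n0 :: real where
      bound: "\<And>n::nat. n0 < real n \<Longrightarrow> birth n / death n \<le> 1 + (\<Sum>i\<le>K. 1 / bertrand i (real n))"
      unfolding log_ratio_bound_eq by blast
    have "\<not> summable r"
      by (intro bertrand_test_divergence[where K = K] scale_inc_pos eventually_mono[OF large[of n0]])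
        (use bound in \<open>simp only: scale_inc_ratio\<close>)
    then show "recurrent M X" by (simp add: criterion)
  }
qed

end
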